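(* Let $\phi$ be the Laplace exponent of a subordinator, let $H(\lambda)=\phi(\lambda)-\lambda\phi'(\lambda)$, and let $\lambda_U\ge0$. Then the following are equivalent: (1) $\phi$ satisfies the upper scaling condition (U) with this $\lambda_U$ and some $\delta<1$, i.e. there exist $\delta\in(0,1)$ and $C_U>0$ such that $\phi(\lambda x)/\phi(\lambda)\le C_Ux^\delta$ for all $\lambda>\lambda_U$ and $x\ge1$; (2) $H(\lambda)\asymp\phi(\lambda)$, $\lambda>\lambda_U$.
   Context: The Laplace exponent of a subordinator $S$ (an increasing $[0,\infty)$-valued Lévy process started at $0$) is the function $\phi$ with $\mathbb{E}e^{-\lambda S_t}=e^{-t\phi(\lambda)}$, $\lambda>0$; it has the form $\phi(\lambda)=b\lambda+\int_{(0,\infty)}(1-e^{-\lambda s})\mu(ds)$ with drift $b\ge0$ and Lévy measure $\mu$ on $(0,\infty)$, $\int_{(0,\infty)}(1\wedge s)\mu(ds)<\infty$. Scaling conditions concern functions with values in $(0,\infty)$, so $\phi$ is understood to be not identically zero. $f(\lambda)\asymp g(\lambda)$, $\lambda\in I$, means there exist constants $c_1,c_2>0$ with $c_1f(\lambda)\le g(\lambda)\le c_2f(\lambda)$ for all $\lambda\in I$. *)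

theory Defs
  imports "HOL-Probability.Probability"
begin

definition cadlag :: "(real \<Rightarrow> real) \<Rightarrow> bool" where
  "cadlag f \<longleftrightarrow>
     (\<forall>t\<ge>0. continuous (at_right t) f) \<and> (\<forall>t>0. \<exists>l. (f \<longlongrightarrow> l) (at_left t))"

text \<open>Only times \<open>t \<ge> 0\<close> are constrained; the values of \<open>S\<close> at negative times are irrelevant.\<close>

locale levy_process = prob_space M for M :: "'a measure" +
  fixes S :: "real \<Rightarrow> 'a \<Rightarrow> real"
  assumes measurable: "t \<ge> 0 \<Longrightarrow> S t \<in> borel_measurable M"
    and start_zero: "AE \<omega> in M. S 0 \<omega> = 0"
    and independent_increments:
      "0 \<le> u 0 \<Longrightarrow> (\<And>i. i < n \<Longrightarrow> u i \<le> u (Suc i)) \<Longrightarrow>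
        indep_vars (\<lambda>_. borel) (\<lambda>i \<omega>. S (u (Suc i)) \<omega> - S (u i) \<omega>) {..<n :: nat}"
    and stationary_increments:
      "0 \<le> s \<Longrightarrow> 0 \<le> h \<Longrightarrow>
        distr M borel (\<lambda>\<omega>. S (s + h) \<omega> - S s \<omega>) = distr M borel (S h)"
    and cadlag_paths: "AE \<omega> in M. cadlag (\<lambda>t. S t \<omega>)"

locale subordinator = levy_process +
  assumes increasing_paths: "AE \<omega> in M. mono_on {0..} (\<lambda>t. S t \<omega>)"
    and nonneg_paths: "AE \<omega> in M. \<forall>t\<ge>0. S t \<omega> \<ge> 0"

text \<open>Only the values of \<open>\<phi>\<close> on \<open>(0, \<infinity>)\<close> are constrained. The exponent is not identically zero
  exactly when the subordinator is not the zero process.\<close>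

definition laplace_exponent :: "'a measure \<Rightarrow> (real \<Rightarrow> 'a \<Rightarrow> real) \<Rightarrow> (real \<Rightarrow> real) \<Rightarrow> bool" where
  "laplace_exponent M S \<phi> \<longleftrightarrow>
     (\<forall>t\<ge>0. \<forall>lam>0. (\<integral>\<omega>. exp (- lam * S t \<omega>) \<partial>M) = exp (- t * \<phi> lam))"

definition H_fun :: "(real \<Rightarrow> real) \<Rightarrow> real \<Rightarrow> real" where
  "H_fun \<phi> lam = \<phi> lam - lam * deriv \<phi> lam"

definition upper_scaling :: "(real \<Rightarrow> real) \<Rightarrow> real \<Rightarrow> real \<Rightarrow> real \<Rightarrow> bool" where
  "upper_scaling \<phi> lamU \<delta> CU \<longleftrightarrow>
     (\<forall>lam>lamU. \<forall>x\<ge>1. \<phi> (lam * x) / \<phi> lam \<le> CU * x powr \<delta>)"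

definition comparable_on :: "real set \<Rightarrow> (real \<Rightarrow> real) \<Rightarrow> (real \<Rightarrow> real) \<Rightarrow> bool" where
  "comparable_on I f g \<longleftrightarrow>
     (\<exists>c1>0. \<exists>c2>0. \<forall>lam\<in>I. c1 * f lam \<le> g lam \<and> g lam \<le> c2 * f lam)"

end

theory Submission
  imports Defs "HOL-Real_Asymp.Real_Asymp"
begin

text \<open>
  Everything rests on one monotonicity: \<open>H(\<lambda>)/\<lambda>\<^sup>2\<close> is decreasing. It needs no Levy-Khintchine
  representation, since \<open>H(\<lambda>)\<close> is the limit of \<open>E[1 - exp (- \<lambda> S\<^sub>t) (1 + \<lambda> S\<^sub>t)] / t\<close> as \<open>t \<rightarrow> 0\<close>,
  and \<open>z \<mapsto> (1 - exp (- z) (1 + z)) / z\<^sup>2\<close> is decreasing on \<open>(0, \<infinity>)\<close>. As \<open>(\<phi>(\<lambda>)/\<lambda>)' = -H(\<lambda>)/\<lambda>\<^sup>2\<close>, the mean value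
  theorem gives \<open>\<phi>(\<lambda>)/\<lambda> - \<phi>(x\<lambda>)/(x\<lambda>) \<le> (x - 1) H(\<lambda>)/\<lambda>\<close>, and upper scaling makes the left side at
  least \<open>\<phi>(\<lambda>)/(2\<lambda>)\<close> for a suitable fixed \<open>x\<close>. Conversely \<open>H \<ge> c\<phi>\<close> says
  \<open>(ln \<phi>)'(\<lambda>) \<le> (1 - c)/\<lambda>\<close>, which integrates to upper scaling with exponent \<open>1 - c\<close>.
\<close>

section \<open>Elementary exponential inequalities\<close>

text \<open>With \<open>z = u * x\<close>, the derivative in \<open>u\<close> has the sign of
  \<open>exp (- z) * (1 + z + z\<^sup>2 / 2) - 1\<close>, which the quadratic Taylor bound for
  \<open>exp z\<close> makes nonpositive. The function \<open>1 - exp (- z) * (1 + z)\<close> is the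
  distribution function of the Gamma law with shape 2.\<close>

lemma antimono_gamma2_cdf_div_square:
  fixes a b x :: real
  assumes "0 < a" "a \<le> b" "0 \<le> x"
  shows "(1 - exp (- b * x) * (1 + b * x)) / b\<^sup>2 \<le> (1 - exp (- a * x) * (1 + a * x)) / a\<^sup>2"
proof (rule DERIV_nonpos_imp_nonincreasing[OF \<open>a \<le> b\<close>])
  fix u assume u: "a \<le> u" "u \<le> b"
  then have "0 < u" using assms by simp
  let ?d = "(exp (- u * x) * (2 + 2 * (u * x) + (u * x)\<^sup>2) - 2) / u ^ 3"
  have "((\<lambda>u. (1 - exp (- u * x) * (1 + u * x)) / u\<^sup>2) has_real_derivative ?d) (at u)"
    using \<open>0 < u\<close>
    by (auto intro!: derivative_eq_intros simp: divide_simps) (simp add: algebra_simps power2_eq_square power3_eq_cube power4_eq_xxxx)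
  moreover have "1 + u * x + (u * x)\<^sup>2 / 2 \<le> exp (u * x)"
    using \<open>0 < u\<close> assms by (intro exp_lower_Taylor_quadratic) auto
  then have "exp (- u * x) * (2 + 2 * (u * x) + (u * x)\<^sup>2) \<le> exp (- u * x) * (2 * exp (u * x))"
    by (intro mult_left_mono) auto
  then have "?d \<le> 0"
    using \<open>0 < u\<close> by (simp add: exp_minus field_simps)
  ultimately show "\<exists>y. ((\<lambda>u. (1 - exp (- u * x) * (1 + u * x)) / u\<^sup>2) has_real_derivative y) (at u) \<and> y \<le> 0"
    by blast
qed

lemma mult_exp_minus_le:
  fixes a x :: real
  assumes "0 < a"
  shows "x * exp (- a * x) \<le> 1 / a"
proof -
  have "a * x \<le> exp (a * x)"
    using exp_ge_add_one_self[of "a * x"] by linarith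
  with assms show ?thesis
    by (simp add: exp_minus field_simps)
qed

text \<open>The Lipschitz constant \<open>1 / c\<close> is uniform in \<open>x\<close>, so it can
  serve as a constant dominating function for difference quotients under the expectation.\<close>

lemma abs_exp_minus_diff_le:
  fixes a b c x :: real
  assumes "0 < c" "c \<le> a" "c \<le> b" "0 \<le> x"
  shows "\<bar>exp (- b * x) - exp (- a * x)\<bar> \<le> \<bar>b - a\<bar> / c"
proof -
  have "norm (exp (- b * x) - exp (- a * x)) \<le> (1 / c) * norm (b - a)"
  proof (rule field_differentiable_bound[of "{c..}"])
    fix u assume "u \<in> {c..}"
    then have "c \<le> u" by simp
    show "((\<lambda>u. exp (- u * x)) has_field_derivative - (x * exp (- u * x))) (at u within {c..})"
      by (auto intro!: derivative_eq_intros)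
    have "x * exp (- u * x) \<le> 1 / u"
      using \<open>c \<le> u\<close> assms by (intro mult_exp_minus_le) auto
    also have "\<dots> \<le> 1 / c"
      using \<open>c \<le> u\<close> assms by (intro divide_left_mono) auto
    finally show "norm (- (x * exp (- u * x))) \<le> 1 / c"
      using assms by simp
  qed (use assms in auto)
  then show ?thesis by simp
qed

section \<open>Differentiating the Laplace transform of a nonnegative random variable\<close>

context prob_space
begin

lemma integrable_exp_minus_mult:
  assumes [measurable]: "X \<in> borel_measurable M" and "AE \<omega> in M. 0 \<le> X \<omega>" "0 < (a::real)"
  shows "integrable M (\<lambda>\<omega>. exp (- a * X \<omega>))"
  using assms(2,3) by (intro integrable_const_bound[where B = 1]) auto

lemma integrable_mult_exp_minus_mult:
  assumes [measurable]: "X \<in> borel_measurable M" and "AE \<omega> in M. 0 \<le> X \<omega>" "0 < (a::real)"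
  shows "integrable M (\<lambda>\<omega>. X \<omega> * exp (- a * X \<omega>))"
proof (rule integrable_const_bound[where B = "1 / a"])
  show "AE \<omega> in M. norm (X \<omega> * exp (- a * X \<omega>)) \<le> 1 / a"
    using assms(2) by eventually_elim (use mult_exp_minus_le[OF \<open>0 < a\<close>] in auto)
qed measurable

text \<open>Dominated convergence, applied along an arbitrary sequence tending to \<open>a\<close>.
  The mean of \<open>X\<close> may be infinite: the bounds come from staying away from 0 in the
  Laplace variable.\<close>

lemma has_real_derivative_laplace_transform:
  fixes a :: real
  assumes [measurable]: "X \<in> borel_measurable M" and nonneg: "AE \<omega> in M. 0 \<le> X \<omega>" and "0 < a"
  shows "((\<lambda>a. expectation (\<lambda>\<omega>. exp (- a * X \<omega>))) has_real_derivative
           - expectation (\<lambda>\<omega>. X \<omega> * exp (- a * X \<omega>))) (at a)"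
  unfolding has_field_derivative_iff tendsto_at_iff_sequentially
proof (intro allI impI)
  fix u :: "nat \<Rightarrow> real"
  assume u: "\<forall>i. u i \<in> UNIV - {a}" "u \<longlonglongrightarrow> a"
  let ?L = "\<lambda>a. expectation (\<lambda>\<omega>. exp (- a * X \<omega>))"
  define q where "q = (\<lambda>n \<omega>. (exp (- u n * X \<omega>) - exp (- a * X \<omega>)) / (u n - a))"
  have near: "\<forall>\<^sub>F n in sequentially. a / 2 < u n"
    using u(2) \<open>0 < a\<close> by (intro order_tendstoD(1)) auto
  then obtain N where N: "\<And>n. n \<ge> N \<Longrightarrow> a / 2 < u n"
    by (auto simp: eventually_sequentially)
  \<comment> \<open>Beyond \<open>N\<close> the points \<open>u n\<close> exceed
    \<open>a / 2\<close>, so the quotients are bounded by \<open>2 / a\<close>. The shift makes this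
    hold at every index, as dominated convergence requires.\<close>
  have "(\<lambda>n. expectation (q (n + N))) \<longlonglongrightarrow> expectation (\<lambda>\<omega>. - (X \<omega> * exp (- a * X \<omega>)))"
  proof (rule integral_dominated_convergence[where w = "\<lambda>_. 2 / a"])
    show "AE \<omega> in M. (\<lambda>n. q (n + N) \<omega>) \<longlonglongrightarrow> - (X \<omega> * exp (- a * X \<omega>))"
    proof (rule AE_I2)
      fix \<omega>
      have "((\<lambda>a. exp (- a * X \<omega>)) has_real_derivative - (X \<omega> * exp (- a * X \<omega>))) (at a)"
        by (auto intro!: derivative_eq_intros)
      then have "(\<lambda>n. q n \<omega>) \<longlonglongrightarrow> - (X \<omega> * exp (- a * X \<omega>))"
        using u unfolding has_field_derivative_iff tendsto_at_iff_sequentially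
        by (auto simp: q_def comp_def)
      then show "(\<lambda>n. q (n + N) \<omega>) \<longlonglongrightarrow> - (X \<omega> * exp (- a * X \<omega>))"
        by (rule LIMSEQ_ignore_initial_segment)
    qed
    show "AE \<omega> in M. norm (q (n + N) \<omega>) \<le> 2 / a" for n
      using nonneg
    proof eventually_elim
      case (elim \<omega>)
      have "\<bar>exp (- u (n + N) * X \<omega>) - exp (- a * X \<omega>)\<bar> \<le> \<bar>u (n + N) - a\<bar> / (a / 2)"
        using N[of "n + N"] \<open>0 < a\<close> elim by (intro abs_exp_minus_diff_le) auto
      then show ?case
        using u(1) \<open>0 < a\<close> by (simp add: q_def field_simps)
    qed
  qed (simp_all add: q_def)
  then have lim: "(\<lambda>n. expectation (q n)) \<longlonglongrightarrow> - expectation (\<lambda>\<omega>. X \<omega> * exp (- a * X \<omega>))"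
    by (simp add: LIMSEQ_offset[where k = N])
  \<comment> \<open>Splitting the expectation uses integrability of both exponentials, which comes
    from \<open>u n > 0\<close>; hence the identity is only eventual.\<close>
  have "\<forall>\<^sub>F n in sequentially. expectation (q n) = (?L (u n) - ?L a) / (u n - a)"
    using near
  proof eventually_elim
    case (elim n)
    with \<open>0 < a\<close> have "0 < u n" by simp
    note integrable_exp_minus_mult[OF assms(1) nonneg]
    from Bochner_Integration.integral_diff[OF this[OF \<open>0 < u n\<close>] this[OF \<open>0 < a\<close>]]
    show ?case
      by (simp only: q_def integral_divide_zero)
  qed
  with lim show "((\<lambda>y. (?L y - ?L a) / (y - a)) \<circ> u) \<longlonglongrightarrow>
      - expectation (\<lambda>\<omega>. X \<omega> * exp (- a * X \<omega>))"
    unfolding comp_def by (rule Lim_transform_eventually)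
qed

end

section \<open>Positivity and differentiability of the exponent\<close>

locale nonzero_laplace_exponent = subordinator +
  fixes \<phi> :: "real \<Rightarrow> real"
  assumes exponent: "laplace_exponent M S \<phi>"
    and nonzero: "\<exists>a>0. \<phi> a \<noteq> 0"
begin

lemma measurable_S [measurable]: "0 \<le> t \<Longrightarrow> S t \<in> borel_measurable M"
  by (rule measurable)

lemma AE_S_nonneg: "0 \<le> t \<Longrightarrow> AE \<omega> in M. 0 \<le> S t \<omega>"
  using nonneg_paths by eventually_elim auto

lemma laplace: "0 \<le> t \<Longrightarrow> 0 < a \<Longrightarrow> expectation (\<lambda>\<omega>. exp (- a * S t \<omega>)) = exp (- t * \<phi> a)"
  using exponent by (simp add: laplace_exponent_def)

text \<open>If \<open>\<phi> a = 0\<close>, the nonnegative variable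
  \<open>1 - exp (- a * S 1 \<omega>)\<close> has mean zero, so \<open>S 1\<close> vanishes almost
  surely and \<open>\<phi>\<close> is zero on the whole half-line, against
  \<open>nonzero\<close>.\<close>

lemma phi_pos:
  assumes "0 < a"
  shows "0 < \<phi> a"
proof -
  have int: "integrable M (\<lambda>\<omega>. exp (- b * S 1 \<omega>))" if "0 < b" for b
    using AE_S_nonneg[of 1] that by (intro integrable_exp_minus_mult) auto
  have ge: "AE \<omega> in M. 0 \<le> 1 - exp (- a * S 1 \<omega>)"
    using AE_S_nonneg[of 1, simplified] by eventually_elim (use assms in auto)
  have E: "expectation (\<lambda>\<omega>. 1 - exp (- a * S 1 \<omega>)) = 1 - exp (- \<phi> a)"
    using laplace[of 1 a] int[OF assms] assms by (simp add: prob_space)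
  have "0 \<le> \<phi> a"
    using integral_nonneg_AE[OF ge] E by simp
  moreover have "\<phi> a \<noteq> 0"
  proof
    assume "\<phi> a = 0"
    then have "expectation (\<lambda>\<omega>. 1 - exp (- a * S 1 \<omega>)) = 0"
      using E by simp
    then have "AE \<omega> in M. 1 - exp (- a * S 1 \<omega>) = 0"
      using integral_nonneg_eq_0_iff_AE[OF _ ge] int[OF assms] by simp
    then have zero: "AE \<omega> in M. S 1 \<omega> = 0"
      by eventually_elim (use assms in auto)
    have "\<phi> b = 0" if "0 < b" for b
    proof -
      have "expectation (\<lambda>\<omega>. exp (- b * S 1 \<omega>)) = expectation (\<lambda>_. 1)"
        by (rule integral_cong_AE) (use zero in auto)
      then show ?thesis
        using laplace[of 1 b] that by (simp add: prob_space)
    qed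
    then show False using nonzero by blast
  qed
  ultimately show ?thesis by simp
qed

text \<open>Differentiability is read off at time 1, where \<open>\<phi>\<close> is minus the
  logarithm of a differentiable Laplace transform. The formula at time \<open>t\<close> then follows
  by differentiating \<open>exp (- t * \<phi> a)\<close> in two ways.\<close>

lemma expectation_mult_exp:
  assumes "0 < t" "0 < a"
  shows "(\<phi> has_real_derivative deriv \<phi> a) (at a)"
    and "expectation (\<lambda>\<omega>. S t \<omega> * exp (- a * S t \<omega>)) = t * deriv \<phi> a * exp (- t * \<phi> a)"
proof -
  have L: "((\<lambda>a. expectation (\<lambda>\<omega>. exp (- a * S t \<omega>))) has_real_derivative
      - expectation (\<lambda>\<omega>. S t \<omega> * exp (- a * S t \<omega>))) (at a)" if "0 < t" for t
    using that assms AE_S_nonneg[of t] by (intro has_real_derivative_laplace_transform) auto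
  have L': "((\<lambda>a. exp (- t * \<phi> a)) has_real_derivative
      - expectation (\<lambda>\<omega>. S t \<omega> * exp (- a * S t \<omega>))) (at a)" if "0 < t" for t
    \<comment> \<open>The Laplace identity is available only for positive arguments, so the two
      functions are exchanged on the open half-line.\<close>
    by (rule has_field_derivative_transform_within_open[OF L, of _ "{0<..}"])
       (use that assms laplace[of t] in auto)
  have "((\<lambda>a. - ln (exp (- 1 * \<phi> a))) has_real_derivative
      expectation (\<lambda>\<omega>. S 1 \<omega> * exp (- a * S 1 \<omega>)) / exp (- 1 * \<phi> a)) (at a)"
    by (rule derivative_eq_intros L'[of 1] | simp)+
  then have "\<phi> field_differentiable at a"
    by (auto simp: field_differentiable_def)
  then show D: "(\<phi> has_real_derivative deriv \<phi> a) (at a)"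
    by (simp add: field_differentiable_derivI)
  have "((\<lambda>a. exp (- t * \<phi> a)) has_real_derivative - (t * deriv \<phi> a * exp (- t * \<phi> a))) (at a)"
    by (rule derivative_eq_intros D | simp)+
  from DERIV_unique[OF this L'[OF \<open>0 < t\<close>]]
  show "expectation (\<lambda>\<omega>. S t \<omega> * exp (- a * S t \<omega>)) = t * deriv \<phi> a * exp (- t * \<phi> a)"
    by simp
qed

lemmas has_derivative_phi = expectation_mult_exp(1)[OF zero_less_one]

lemma deriv_phi_nonneg:
  assumes "0 < a"
  shows "0 \<le> deriv \<phi> a"
proof -
  have "0 \<le> expectation (\<lambda>\<omega>. S 1 \<omega> * exp (- a * S 1 \<omega>))"
    using AE_S_nonneg[of 1] by (intro integral_nonneg_AE) auto
  then show ?thesis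
    using expectation_mult_exp(2)[of 1 a] assms by (simp add: zero_le_mult_iff)
qed

section \<open>Monotonicity of \<open>H_fun \<phi> a / a\<^sup>2\<close> and the mean value
  estimate\<close>

lemma H_fun_div_square_antimono:
  assumes "0 < a" "a \<le> b"
  shows "H_fun \<phi> b / b\<^sup>2 \<le> H_fun \<phi> a / a\<^sup>2"
proof -
  \<comment> \<open>This is the closed form of the expectation divided by \<open>t\<close>. Its
    limit at 0 is a computation with real functions of \<open>t\<close>, so no limit is exchanged
    with an expectation.\<close>
  define h where
    "h t a = (1 - exp (- t * \<phi> a) - a * (t * deriv \<phi> a * exp (- t * \<phi> a))) / t" for t a
  have lim: "((\<lambda>t. h t a / a\<^sup>2) \<longlongrightarrow> H_fun \<phi> a / a\<^sup>2) (at_right 0)" for a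
  proof -
    have "((\<lambda>t. (1 - exp (- t * p) - a * (t * d * exp (- t * p))) / t) \<longlongrightarrow> p - a * d) (at_right 0)"
      for p d :: real
      by real_asymp
    from tendsto_mult_right[OF this[of "\<phi> a" "deriv \<phi> a"], of "inverse (a\<^sup>2)"]
    show ?thesis
      by (simp add: h_def H_fun_def divide_inverse)
  qed
  have h_eq: "h t a = expectation (\<lambda>\<omega>. 1 - exp (- a * S t \<omega>) * (1 + a * S t \<omega>)) / t"
    and h_int: "integrable M (\<lambda>\<omega>. 1 - exp (- a * S t \<omega>) * (1 + a * S t \<omega>))"
    if "0 < t" "0 < a" for t a
  proof -
    have i1: "integrable M (\<lambda>\<omega>. exp (- a * S t \<omega>))"
      and i2: "integrable M (\<lambda>\<omega>. S t \<omega> * exp (- a * S t \<omega>))"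
      using that AE_S_nonneg[of t]
      by (intro integrable_exp_minus_mult integrable_mult_exp_minus_mult; simp)+
    have eq: "1 - exp (- a * x) * (1 + a * x) = 1 - exp (- a * x) - a * (x * exp (- a * x))" for x
      by (simp add: algebra_simps)
    show "integrable M (\<lambda>\<omega>. 1 - exp (- a * S t \<omega>) * (1 + a * S t \<omega>))"
      unfolding eq using i1 i2 by (intro Bochner_Integration.integrable_diff integrable_mult_right) auto
    have "expectation (\<lambda>\<omega>. 1 - exp (- a * S t \<omega>) * (1 + a * S t \<omega>)) =
        1 - exp (- t * \<phi> a) - a * (t * deriv \<phi> a * exp (- t * \<phi> a))"
      unfolding eq using i1 i2 laplace[of t a] expectation_mult_exp(2)[of t a] that
      by (simp add: prob_space)
    then show "h t a = expectation (\<lambda>\<omega>. 1 - exp (- a * S t \<omega>) * (1 + a * S t \<omega>)) / t"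
      by (simp add: h_def)
  qed
  have "h t b / b\<^sup>2 \<le> h t a / a\<^sup>2" if "0 < t" for t
  proof -
    have "expectation (\<lambda>\<omega>. (1 - exp (- b * S t \<omega>) * (1 + b * S t \<omega>)) / b\<^sup>2) \<le>
        expectation (\<lambda>\<omega>. (1 - exp (- a * S t \<omega>) * (1 + a * S t \<omega>)) / a\<^sup>2)"
    proof (rule integral_mono_AE)
      show "AE \<omega> in M. (1 - exp (- b * S t \<omega>) * (1 + b * S t \<omega>)) / b\<^sup>2 \<le>
          (1 - exp (- a * S t \<omega>) * (1 + a * S t \<omega>)) / a\<^sup>2"
        using AE_S_nonneg[OF less_imp_le[OF that]]
        by eventually_elim (rule antimono_gamma2_cdf_div_square[OF assms])
    qed (use h_int that assms in auto)
    then have "expectation (\<lambda>\<omega>. 1 - exp (- b * S t \<omega>) * (1 + b * S t \<omega>)) / b\<^sup>2 / t \<le>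
        expectation (\<lambda>\<omega>. 1 - exp (- a * S t \<omega>) * (1 + a * S t \<omega>)) / a\<^sup>2 / t"
      using that by (intro divide_right_mono) auto
    then show ?thesis
      using that assms by (simp add: h_eq divide_divide_eq_left mult.commute)
  qed
  then have "\<forall>\<^sub>F t in at_right 0. h t b / b\<^sup>2 \<le> h t a / a\<^sup>2"
    by (auto simp: eventually_at_filter)
  then show ?thesis
    by (rule tendsto_le[OF trivial_limit_at_right_real lim lim])
qed

lemma H_fun_le: "0 < a \<Longrightarrow> H_fun \<phi> a \<le> \<phi> a"
  using deriv_phi_nonneg[of a] by (simp add: H_fun_def)

lemma phi_div_diff_le_H_fun:
  assumes "0 < a" "1 < x"
  shows "\<phi> a / a - \<phi> (a * x) / (a * x) \<le> (x - 1) * H_fun \<phi> a / a"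
proof -
  have "\<exists>z>a. z < a * x \<and>
      \<phi> (a * x) / (a * x) - \<phi> a / a = (a * x - a) * (- (H_fun \<phi> z / z\<^sup>2))"
  proof (rule MVT2)
    fix z assume "a \<le> z" "z \<le> a * x"
    with assms have "0 < z" by linarith
    then show "((\<lambda>y. \<phi> y / y) has_real_derivative - (H_fun \<phi> z / z\<^sup>2)) (at z)"
      by (auto intro!: derivative_eq_intros has_derivative_phi
               simp: H_fun_def field_simps power2_eq_square)
  qed (use assms in simp)
  then obtain z where z: "a < z"
    "\<phi> a / a - \<phi> (a * x) / (a * x) = (a * x - a) * (H_fun \<phi> z / z\<^sup>2)"
    by (auto simp: algebra_simps)
  \<comment> \<open>The intermediate point \<open>z\<close> is unknown but lies above
    \<open>a\<close>, so monotonicity replaces it by \<open>a\<close>.\<close>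
  have "(a * x - a) * (H_fun \<phi> z / z\<^sup>2) \<le> (a * x - a) * (H_fun \<phi> a / a\<^sup>2)"
    using assms z(1) by (intro mult_left_mono H_fun_div_square_antimono) auto
  also have "\<dots> = (x - 1) * H_fun \<phi> a / a"
    using assms by (simp add: field_simps power2_eq_square)
  finally show ?thesis
    using z(2) by simp
qed

section \<open>The two implications\<close>

lemma comparable_on_if_upper_scaling:
  assumes "0 \<le> l" "\<delta> < 1" "upper_scaling \<phi> l \<delta> C"
  shows "comparable_on {l<..} (H_fun \<phi>) \<phi>"
proof -
  \<comment> \<open>The chosen \<open>x\<close> depends only on \<open>C\<close> and
    \<open>\<delta>\<close>, so the comparison constant \<open>2 * (x - 1)\<close> is uniform in
    \<open>a\<close>.\<close>
  have "((\<lambda>x. C * x powr (\<delta> - 1)) \<longlongrightarrow> 0) at_top"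
    using \<open>\<delta> < 1\<close> by real_asymp
  then have "\<forall>\<^sub>F x in at_top. C * x powr (\<delta> - 1) < 1 / 2"
    by (rule order_tendstoD) simp
  then have "\<forall>\<^sub>F x in at_top. C * x powr (\<delta> - 1) < 1 / 2 \<and> 1 < x"
    using eventually_gt_at_top by (rule eventually_conj)
  then obtain x where x: "C * x powr (\<delta> - 1) < 1 / 2" "1 < x"
    by (auto dest!: eventually_happens)
  have "\<phi> a \<le> 2 * (x - 1) * H_fun \<phi> a" if "l < a" for a
  proof -
    have "0 < a" using assms that by simp
    have "\<phi> (a * x) \<le> C * x powr \<delta> * \<phi> a"
      using assms(3) that x(2) phi_pos[OF \<open>0 < a\<close>] by (auto simp: upper_scaling_def divide_le_eq)
    then have "\<phi> (a * x) / x \<le> C * x powr (\<delta> - 1) * \<phi> a"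
      using x(2) by (simp add: powr_diff field_simps)
    also have "\<dots> \<le> 1 / 2 * \<phi> a"
      using x(1) phi_pos[OF \<open>0 < a\<close>] by (intro mult_right_mono) auto
    finally have "\<phi> a / 2 \<le> \<phi> a - \<phi> (a * x) / x" by simp
    also have "\<dots> = a * (\<phi> a / a - \<phi> (a * x) / (a * x))"
      using \<open>0 < a\<close> x(2) by (simp add: field_simps)
    also have "\<dots> \<le> a * ((x - 1) * H_fun \<phi> a / a)"
      using \<open>0 < a\<close> x(2) by (intro mult_left_mono phi_div_diff_le_H_fun) auto
    also have "\<dots> = (x - 1) * H_fun \<phi> a"
      using \<open>0 < a\<close> by simp
    finally have "\<phi> a \<le> 2 * ((x - 1) * H_fun \<phi> a)" by linarith
    then show ?thesis by (simp only: mult.assoc)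
  qed
  then have "\<forall>a\<in>{l<..}. 1 * H_fun \<phi> a \<le> \<phi> a \<and> \<phi> a \<le> 2 * (x - 1) * H_fun \<phi> a"
    using H_fun_le \<open>0 \<le> l\<close> by simp
  moreover have "0 < 2 * (x - 1)"
    using x(2) by simp
  ultimately show ?thesis
    unfolding comparable_on_def using zero_less_one by blast
qed

text \<open>The hypothesis makes \<open>ln (\<phi> z) - (1 - c) * ln z\<close> nonincreasing above
  \<open>l\<close>; comparing its values at \<open>a\<close> and \<open>a * x\<close> and
  exponentiating gives the scaling constant 1.\<close>

lemma upper_scaling_if_H_fun_ge:
  assumes "0 \<le> l" "\<And>a. l < a \<Longrightarrow> c * \<phi> a \<le> H_fun \<phi> a"
  shows "upper_scaling \<phi> l (1 - c) 1"
  unfolding upper_scaling_def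
proof (intro allI impI)
  fix a x :: real assume "l < a" "1 \<le> x"
  then have "0 < a" using assms by simp
  have "ln (\<phi> (a * x)) - (1 - c) * ln (a * x) \<le> ln (\<phi> a) - (1 - c) * ln a"
  proof (rule DERIV_nonpos_imp_nonincreasing[where f = "\<lambda>z. ln (\<phi> z) - (1 - c) * ln z"])
    show "a \<le> a * x"
      using \<open>0 < a\<close> \<open>1 \<le> x\<close> by simp
    fix z assume "a \<le> z" "z \<le> a * x"
    then have "0 < z" "l < z" using \<open>0 < a\<close> \<open>l < a\<close> by auto
    have "((\<lambda>z. ln (\<phi> z) - (1 - c) * ln z) has_real_derivative
        deriv \<phi> z / \<phi> z - (1 - c) / z) (at z)"
      using \<open>0 < z\<close> phi_pos[OF \<open>0 < z\<close>]
      by (auto intro!: derivative_eq_intros has_derivative_phi)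
    moreover have "deriv \<phi> z / \<phi> z - (1 - c) / z \<le> 0"
      using assms(2)[OF \<open>l < z\<close>] \<open>0 < z\<close> phi_pos[OF \<open>0 < z\<close>]
      by (simp add: H_fun_def field_simps)
    ultimately show "\<exists>y. ((\<lambda>z. ln (\<phi> z) - (1 - c) * ln z) has_real_derivative y) (at z) \<and> y \<le> 0"
      by blast
  qed
  then have "ln (\<phi> (a * x) / \<phi> a) \<le> (1 - c) * ln x"
    using \<open>0 < a\<close> \<open>1 \<le> x\<close> phi_pos[of a] phi_pos[of "a * x"]
    by (simp add: ln_div ln_mult algebra_simps)
  then have "exp (ln (\<phi> (a * x) / \<phi> a)) \<le> exp ((1 - c) * ln x)"
    by simp
  then show "\<phi> (a * x) / \<phi> a \<le> 1 * x powr (1 - c)"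
    using \<open>0 < a\<close> \<open>1 \<le> x\<close> phi_pos[of a] phi_pos[of "a * x"] by (simp add: powr_def)
qed

lemma upper_scaling_if_comparable_on:
  assumes "0 \<le> l" "comparable_on {l<..} (H_fun \<phi>) \<phi>"
  shows "\<exists>\<delta> C. 0 < \<delta> \<and> \<delta> < 1 \<and> C > 0 \<and> upper_scaling \<phi> l \<delta> C"
proof -
  obtain c2 where c2: "c2 > 0" "\<And>a. l < a \<Longrightarrow> \<phi> a \<le> c2 * H_fun \<phi> a"
    using assms(2) by (auto simp: comparable_on_def)
  \<comment> \<open>The bound \<open>1 / c2\<close> turns comparability into
    \<open>c * \<phi> a \<le> H_fun \<phi> a\<close>; the cap \<open>1 / 2\<close> keeps the
    exponent \<open>1 - c\<close> strictly positive.\<close>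
  define c where "c = min (1 / 2) (1 / c2)"
  have "c * \<phi> a \<le> H_fun \<phi> a" if "l < a" for a
  proof -
    have "c * \<phi> a \<le> 1 / c2 * \<phi> a"
      using phi_pos[of a] that \<open>0 \<le> l\<close> by (intro mult_right_mono) (auto simp: c_def)
    also have "\<dots> \<le> H_fun \<phi> a"
      using c2(2)[OF that] c2(1) by (simp add: field_simps)
    finally show ?thesis .
  qed
  then have "upper_scaling \<phi> l (1 - c) 1"
    by (rule upper_scaling_if_H_fun_ge[OF \<open>0 \<le> l\<close>])
  moreover have "0 < 1 - c" "1 - c < 1"
    using c2(1) by (auto simp: c_def)
  ultimately show ?thesis
    using zero_less_one by blast
qed

end

theorem proposition2p9:
  fixes M :: "'a measure" and S :: "real \<Rightarrow> 'a \<Rightarrow> real"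
    and \<phi> :: "real \<Rightarrow> real" and lamU :: real
  assumes "subordinator M S"
    and "laplace_exponent M S \<phi>"
    and "\<exists>lam>0. \<phi> lam \<noteq> 0"
    and "lamU \<ge> 0"
  shows "(\<exists>\<delta> CU. 0 < \<delta> \<and> \<delta> < 1 \<and> CU > 0 \<and> upper_scaling \<phi> lamU \<delta> CU) \<longleftrightarrow>
    comparable_on {lamU<..} (H_fun \<phi>) \<phi>"
proof -
  interpret nonzero_laplace_exponent M S \<phi>
    using assms by (intro nonzero_laplace_exponent.intro nonzero_laplace_exponent_axioms.intro)
  show ?thesis
    using comparable_on_if_upper_scaling[OF \<open>lamU \<ge> 0\<close>]
      upper_scaling_if_comparable_on[OF \<open>lamU \<ge> 0\<close>] by blast
qed

end
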